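(* Let $(X,d)$ be a compact metric space, let $\mathbb{I}=\{S_i\}_{i=1}^N$ be an iterated function system on $X$ consisting of bi-Lipschitz contractions, and let $C\subseteq X$ be a non-empty compact set. Let $F_\emptyset$ be the homogeneous attractor of $\mathbb{I}$, let $F_C$ be the inhomogeneous attractor of $\mathbb{I}$ with condensation set $C$, and let $s$ be the upper Lipschitz dimension of $\mathbb{I}$. Then $$\max\{\overline{\dim}_B F_\emptyset,\ \overline{\dim}_B C\}\ \le\ \overline{\dim}_B F_C\ \le\ \max\{s,\ \overline{\dim}_B C\}.$$
   Context: An iterated function system (IFS) on $X$ is a finite collection $\mathbb{I}=\{S_i\}_{i=1}^N$ of contractions $S_i:X\to X$. Its homogeneous attractor $F_\emptyset$ is the unique non-empty compact set with $F_\emptyset=\bigcup_{i=1}^N S_i(F_\emptyset)$. For compact $C\subseteq X$, the inhomogeneous attractor $F_C$ with condensation set $C$ is the unique non-empty compact set with $F_C=\bigcup_{i=1}^N S_i(F_C)\cup C$. For $S:X\to X$ let $\mathrm{Lip}^+(S)=\sup_{x\ne y} d(S(x),S(y))/d(x,y)$ and $\mathrm{Lip}^-(S)=\inf_{x\neq y} d(S(x),S(y))/d(x,y)$. The map $S$ is a bi-Lipschitz contraction if $0<\mathrm{Lip}^-(S)\le \mathrm{Lip}^+(S)<1$. Let $\mathcal{I}=\{1,\dots,N\}$ and for $\mathbf{i}=(i_1,\dots,i_k)\in\mathcal{I}^k$ write $S_{\mathbf{i}}=S_{i_1}\circ\cdots\circ S_{i_k}$. For each $k\in\mathbb{N}$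 let $s_k$ be the solution of $\sum_{\mathbf{i}\in\mathcal{I}^k}\mathrm{Lip}^+(S_{\mathbf{i}})^{s_k}=1$. The upper Lipschitz dimension of $\mathbb{I}$ is $s=\lim_{k\to\infty}s_k$. This limit exists and equals the unique zero of the pressure function $P(t)=\lim_{k\to\infty}\frac1k\log\sum_{\mathbf{i}\in\mathcal{I}^k}\mathrm{Lip}^+(S_{\mathbf{i}})^t$. For a non-empty set $F\subseteq X$, $\overline{\dim}_B F=\limsup_{\delta\to0}\frac{\log N_\delta(F)}{-\log\delta}$, where $N_\delta(F)$ is the minimum number of balls of diameter $\delta$ required to cover $F$. *)

theory Defs
  imports "HOL-Analysis.Analysis"
begin

definition contraction_map :: "('a::metric_space \<Rightarrow> 'a) \<Rightarrow> bool" where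
  "contraction_map f \<longleftrightarrow> (\<exists>c<1. c-lipschitz_on UNIV f)"

(* The functions of the system are f 1, ..., f N; repetitions are allowed. *)
definition iterated_function_system :: "nat \<Rightarrow> (nat \<Rightarrow> 'a::metric_space \<Rightarrow> 'a) \<Rightarrow> bool" where
  "iterated_function_system N f \<longleftrightarrow> N \<ge> 1 \<and> (\<forall>i\<in>{1..N}. contraction_map (f i))"

(* For C = {} this is the homogeneous attractor. *)
definition attractor :: "nat \<Rightarrow> (nat \<Rightarrow> 'a::metric_space \<Rightarrow> 'a) \<Rightarrow> 'a set \<Rightarrow> 'a set" where
  "attractor N f C = (THE F. F \<noteq> {} \<and> compact F \<and> F = (\<Union>i\<in>{1..N}. f i ` F) \<union> C)"

(* Supremum and infimum are taken in the reals, so Lip_upper f is meaningful only if f is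
   Lipschitz, and both are meaningful only if the space has at least two points. *)
definition Lip_upper :: "('a::metric_space \<Rightarrow> 'a) \<Rightarrow> real" where
  "Lip_upper f = Sup {dist (f x) (f y) / dist x y | x y. x \<noteq> y}"

definition Lip_lower :: "('a::metric_space \<Rightarrow> 'a) \<Rightarrow> real" where
  "Lip_lower f = Inf {dist (f x) (f y) / dist x y | x y. x \<noteq> y}"

(* The first conjunct makes the set of difference quotients bounded, so that Lip_upper f is
   their actual supremum. On a one-point space no map satisfies the predicate, because there
   Lip_lower f = - Lip_upper f. *)
definition bi_lipschitz_contraction :: "('a::metric_space \<Rightarrow> 'a) \<Rightarrow> bool" where
  "bi_lipschitz_contraction f \<longleftrightarrow>
     contraction_map f \<and> 0 < Lip_lower f \<and> Lip_lower f \<le> Lip_upper f \<and> Lip_upper f < 1"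

definition words :: "nat \<Rightarrow> nat \<Rightarrow> nat list set" where
  "words N k = {w. length w = k \<and> set w \<subseteq> {1..N}}"

fun comp_word :: "(nat \<Rightarrow> 'a \<Rightarrow> 'a) \<Rightarrow> nat list \<Rightarrow> 'a \<Rightarrow> 'a" where
  "comp_word f [] = id"
| "comp_word f (i # w) = f i \<circ> comp_word f w"

(* The solution is unique for k \<ge> 1; the value at k = 0 is irrelevant for the limit below. *)
definition level_exponent :: "nat \<Rightarrow> (nat \<Rightarrow> 'a::metric_space \<Rightarrow> 'a) \<Rightarrow> nat \<Rightarrow> real" where
  "level_exponent N f k = (THE t. (\<Sum>w\<in>words N k. Lip_upper (comp_word f w) powr t) = 1)"

definition upper_Lipschitz_dim :: "nat \<Rightarrow> (nat \<Rightarrow> 'a::metric_space \<Rightarrow> 'a) \<Rightarrow> real" where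
  "upper_Lipschitz_dim N f = lim (level_exponent N f)"

(* A ball of diameter \<delta> is read as a closed ball of radius \<delta>/2, centred anywhere in the space.
   For totally bounded F a finite cover exists, so the minimum is attained. *)
definition covering_number :: "real \<Rightarrow> 'a::metric_space set \<Rightarrow> nat" where
  "covering_number \<delta> F = (LEAST n. \<exists>A. finite A \<and> card A = n \<and> F \<subseteq> (\<Union>x\<in>A. cball x (\<delta> / 2)))"

(* Extended-real valued: a compact metric space may have infinite box dimension. *)
definition upper_box_dim :: "'a::metric_space set \<Rightarrow> ereal" where
  "upper_box_dim F =
     Limsup (at_right 0) (\<lambda>\<delta>. ereal (ln (real (covering_number \<delta> F)) / - ln \<delta>))"

end

theory Submission
  imports Defs
begin

text \<open>
  A closed set containing its own image and the condensation set also contains every compact set that is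
  covered by its own image and the condensation set, because the maximal distance from the latter
  to the former would otherwise contract. This gives uniqueness of the attractors and
  \<open>F\<^sub>\<emptyset> \<union> C \<subseteq> F\<^sub>C\<close>, hence the lower bound.

  For the upper bound let \<open>t > s\<close> exceed the upper box dimension of \<open>C\<close>. The sums
  \<open>\<Sum>\<^bsub>|w|=k\<^esub> Lip\<^sup>+(S\<^sub>w)\<^sup>t\<close> are submultiplicative in \<open>k\<close>, so the level exponents converge to their
  infimum and one of the sums, at level \<open>m\<close> say, is less than 1. As \<open>F\<^sub>C\<close> is the union of the
  \<open>S\<^sub>w(F\<^sub>C)\<close> with \<open>|w| = m\<close> and of finitely many contracted copies of \<open>C\<close>, its covering numbers
  satisfy \<open>N\<^sub>\<delta> \<le> \<Sum>\<^bsub>|w|=m\<^esub> N\<^bsub>\<delta>/Lip\<^sup>+(S\<^sub>w)\<^esub> + K \<delta>\<^bsup>-t\<^esup>\<close>, and this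
  recursion yields \<open>N\<^sub>\<delta> = O(\<delta>\<^bsup>-t\<^esup>)\<close>.
\<close>

section \<open>Lipschitz constants\<close>

text \<open>The Lipschitz hypothesis only serves to bound the set of quotients, so that the real
  \<open>Sup\<close> really is an upper bound; the value of \<open>c\<close> does not enter the
  conclusion.\<close>

lemma Lip_upper_bound:
  assumes "c-lipschitz_on UNIV g"
  shows "dist (g x) (g y) \<le> Lip_upper g * dist x y"
proof (cases "x = y")
  case False
  have "bdd_above {dist (g x) (g y) / dist x y | x y. x \<noteq> y}"
    by (rule bdd_aboveI[of _ c]) (use lipschitz_onD[OF assms] in \<open>auto simp: pos_divide_le_eq\<close>)
  then have "dist (g x) (g y) / dist x y \<le> Lip_upper g"
    unfolding Lip_upper_def using False by (intro cSup_upper) auto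
  with False show ?thesis by (simp add: divide_simps)
qed simp

text \<open>Two distinct points make the set of quotients non-empty; the real \<open>Sup\<close> of
  the empty set would carry no information.\<close>

lemma Lip_upper_least:
  fixes g :: "'a::metric_space \<Rightarrow> 'a" and a b :: 'a
  assumes "a \<noteq> b" and "\<And>x y. dist (g x) (g y) \<le> c * dist x y"
  shows "Lip_upper g \<le> c"
  unfolding Lip_upper_def
proof (rule cSup_least)
  show "{dist (g x) (g y) / dist x y | x y. x \<noteq> y} \<noteq> {}" using assms(1) by auto
qed (use assms(2) in \<open>auto simp: pos_divide_le_eq\<close>)

lemma Lip_lower_bound: "Lip_lower g * dist x y \<le> dist (g x) (g y)"
proof (cases "x = y")
  case False
  have "bdd_below {dist (g x) (g y) / dist x y | x y. x \<noteq> y}"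
    by (rule bdd_belowI[of _ 0]) auto
  then have "Lip_lower g \<le> dist (g x) (g y) / dist x y"
    unfolding Lip_lower_def using False by (intro cInf_lower) auto
  with False show ?thesis by (simp add: divide_simps)
qed simp

lemma bi_lipschitz_contraction_inj:
  assumes "bi_lipschitz_contraction g"
  shows "inj g"
proof (rule injI)
  fix x y assume "g x = g y"
  then have "Lip_lower g * dist x y \<le> 0" using Lip_lower_bound[of g x y] by simp
  with assms show "x = y"
    by (simp add: bi_lipschitz_contraction_def mult_le_0_iff not_le)
qed

lemma bi_lipschitz_contraction_lipschitz:
  assumes "bi_lipschitz_contraction g"
  shows "(Lip_upper g)-lipschitz_on UNIV g"
proof -
  obtain c where "c-lipschitz_on UNIV g"
    using assms unfolding bi_lipschitz_contraction_def contraction_map_def by blast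
  from Lip_upper_bound[OF this] assms show ?thesis
    by (auto simp: bi_lipschitz_contraction_def intro!: lipschitz_onI)
qed

lemma bi_lipschitz_contraction_two_points:
  fixes g :: "'a::metric_space \<Rightarrow> 'a"
  assumes "bi_lipschitz_contraction g"
  shows "\<exists>a b :: 'a. a \<noteq> b"
proof (rule ccontr)
  assume "\<not> ?thesis"
  then have "{dist (g x) (g y) / dist x y | x y. x \<noteq> y} = {}" by blast
  \<comment> \<open>\<open>Inf_real_def\<close> defines \<open>Inf\<close> as the negated
    \<open>Sup\<close> of the negated set, and negation fixes the empty set.\<close>
  then have "Lip_lower g = - Lip_upper g"
    unfolding Lip_lower_def Lip_upper_def by (simp add: Inf_real_def)
  with assms show False by (auto simp: bi_lipschitz_contraction_def)
qed

section \<open>Covering numbers and box dimension\<close>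

lemma covering_number_le:
  assumes "finite A" "F \<subseteq> (\<Union>x\<in>A. cball x (\<delta> / 2))"
  shows "covering_number \<delta> F \<le> card A"
  unfolding covering_number_def using assms by (intro Least_le) auto

text \<open>Total boundedness of the whole space provides a finite cover, so the
  \<open>LEAST\<close> in the definition is a true minimum for every \<open>F\<close>.\<close>

lemma covering_number_attained:
  fixes F :: "'a::metric_space set"
  assumes "compact (UNIV :: 'a set)" "0 < \<delta>"
  obtains A where "finite A" "card A = covering_number \<delta> F" "F \<subseteq> (\<Union>x\<in>A. cball x (\<delta> / 2))"
proof -
  have "\<forall>e>0. \<exists>k. finite k \<and> k \<subseteq> UNIV \<and> (UNIV :: 'a set) \<subseteq> (\<Union>x\<in>k. ball x e)"
    using compact_imp_seq_compact[OF assms(1)] seq_compact_imp_totally_bounded by blast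
  then obtain k where "finite k" "(UNIV :: 'a set) \<subseteq> (\<Union>x\<in>k. ball x (\<delta> / 2))"
    using assms(2) by (meson half_gt_zero)
  moreover from this have "F \<subseteq> (\<Union>x\<in>k. cball x (\<delta> / 2))"
    by (meson UN_mono ball_subset_cball order_trans subset_UNIV order_refl)
  ultimately have "\<exists>n A. finite A \<and> card A = n \<and> F \<subseteq> (\<Union>x\<in>A. cball x (\<delta> / 2))" by blast
  from LeastI_ex[OF this] show thesis
    unfolding covering_number_def[symmetric] using that by blast
qed

context
  assumes compact_space: "compact (UNIV :: 'a::metric_space set)"
begin

lemma covering_number_mono:
  fixes E F :: "'a set"
  assumes "0 < \<delta>" "E \<subseteq> F"
  shows "covering_number \<delta> E \<le> covering_number \<delta> F"
proof -
  obtain A where "finite A" "card A = covering_number \<delta> F" "F \<subseteq> (\<Union>x\<in>A. cball x (\<delta> / 2))"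
    using covering_number_attained[OF compact_space assms(1)] .
  with assms(2) show ?thesis using covering_number_le[of A E \<delta>] by auto
qed

lemma covering_number_antimono:
  fixes F :: "'a set"
  assumes "0 < \<epsilon>" "\<epsilon> \<le> \<delta>"
  shows "covering_number \<delta> F \<le> covering_number \<epsilon> F"
proof -
  obtain A where A: "finite A" "card A = covering_number \<epsilon> F" "F \<subseteq> (\<Union>x\<in>A. cball x (\<epsilon> / 2))"
    using covering_number_attained[OF compact_space assms(1)] .
  have "(\<Union>x\<in>A. cball x (\<epsilon> / 2)) \<subseteq> (\<Union>x\<in>A. cball x (\<delta> / 2))"
    using assms(2) by (intro UN_mono) auto
  with A show ?thesis using covering_number_le[of A F \<delta>] by auto
qed

lemma covering_number_ge_1:
  fixes F :: "'a set"
  assumes "0 < \<delta>" "F \<noteq> {}"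
  shows "1 \<le> covering_number \<delta> F"
proof -
  obtain A where A: "finite A" "card A = covering_number \<delta> F" "F \<subseteq> (\<Union>x\<in>A. cball x (\<delta> / 2))"
    using covering_number_attained[OF compact_space assms(1)] .
  with assms(2) have "A \<noteq> {}" by auto
  with A show ?thesis by (metis One_nat_def Suc_leI card_gt_0_iff)
qed

lemma covering_number_Un:
  fixes E F :: "'a set"
  assumes "0 < \<delta>"
  shows "covering_number \<delta> (E \<union> F) \<le> covering_number \<delta> E + covering_number \<delta> F"
proof -
  obtain A where A: "finite A" "card A = covering_number \<delta> E" "E \<subseteq> (\<Union>x\<in>A. cball x (\<delta> / 2))"
    using covering_number_attained[OF compact_space assms(1)] .
  obtain B where B: "finite B" "card B = covering_number \<delta> F" "F \<subseteq> (\<Union>x\<in>B. cball x (\<delta> / 2))"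
    using covering_number_attained[OF compact_space assms(1)] .
  have "covering_number \<delta> (E \<union> F) \<le> card (A \<union> B)"
    using A B by (intro covering_number_le) auto
  also have "\<dots> \<le> card A + card B" by (rule card_Un_le)
  finally show ?thesis using A B by simp
qed

lemma covering_number_UN:
  fixes F :: "'b \<Rightarrow> 'a set"
  assumes "0 < \<delta>" "finite I"
  shows "covering_number \<delta> (\<Union>i\<in>I. F i) \<le> (\<Sum>i\<in>I. covering_number \<delta> (F i))"
  using assms(2)
proof (induction I)
  case empty
  show ?case using covering_number_le[of "{}" "{}"] by simp
next
  case (insert i I)
  then show ?case
    using covering_number_Un[OF assms(1), of "F i" "\<Union>i\<in>I. F i"] by simp
qed

text \<open>Pushing the centres of an optimal cover forward by \<open>g\<close> multiplies the
  admissible radius by \<open>L\<close>.\<close>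

lemma covering_number_image:
  fixes F :: "'a set" and g :: "'a \<Rightarrow> 'b::metric_space"
  assumes "0 < \<delta>" "0 < L" and g: "\<And>x y. dist (g x) (g y) \<le> L * dist x y"
  shows "covering_number \<delta> (g ` F) \<le> covering_number (\<delta> / L) F"
proof -
  obtain A where A: "finite A" "card A = covering_number (\<delta> / L) F"
      "F \<subseteq> (\<Union>x\<in>A. cball x (\<delta> / L / 2))"
    using covering_number_attained[OF compact_space, of "\<delta> / L"] assms by auto
  have "g ` F \<subseteq> (\<Union>x\<in>g ` A. cball x (\<delta> / 2))"
  proof
    fix y assume "y \<in> g ` F"
    then obtain z where z: "z \<in> F" "y = g z" by auto
    then obtain a where a: "a \<in> A" "dist a z \<le> \<delta> / L / 2" using A by auto
    have "dist (g a) (g z) \<le> L * dist a z" by (rule g)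
    also have "\<dots> \<le> L * (\<delta> / L / 2)" using a assms by (intro mult_left_mono) auto
    also have "\<dots> = \<delta> / 2" using assms by simp
    finally show "y \<in> (\<Union>x\<in>g ` A. cball x (\<delta> / 2))" using a z by auto
  qed
  then have "covering_number \<delta> (g ` F) \<le> card (g ` A)"
    using A by (intro covering_number_le) auto
  also have "\<dots> \<le> card A" using A by (intro card_image_le)
  finally show ?thesis using A by simp
qed

section \<open>Upper box dimension and power bounds on covering numbers\<close>

lemma eventually_at_right_0_less_1: "eventually (\<lambda>\<delta>. 0 < \<delta> \<and> \<delta> < (1::real)) (at_right 0)"
  by (rule eventually_at_rightI[of 0 1]) auto

lemma upper_box_dim_mono:
  fixes E F :: "'a set"
  assumes "E \<noteq> {}" "E \<subseteq> F"
  shows "upper_box_dim E \<le> upper_box_dim F"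
  unfolding upper_box_dim_def
proof (rule Limsup_mono)
  show "\<forall>\<^sub>F \<delta> in at_right 0. ereal (ln (real (covering_number \<delta> E)) / - ln \<delta>)
          \<le> ereal (ln (real (covering_number \<delta> F)) / - ln \<delta>)"
    using eventually_at_right_0_less_1
  proof eventually_elim
    case (elim \<delta>)
    then have "1 \<le> covering_number \<delta> E" "covering_number \<delta> E \<le> covering_number \<delta> F"
      using covering_number_ge_1 covering_number_mono assms by auto
    then have "ln (real (covering_number \<delta> E)) \<le> ln (real (covering_number \<delta> F))" by simp
    with elim show ?case
      by (simp add: divide_right_mono_neg)
  qed
qed

text \<open>After taking logarithms the constant contributes \<open>ln M / - ln \<delta>\<close>,
  which tends to 0.\<close>

lemma upper_box_dim_leI:
  fixes F :: "'a set"
  assumes "F \<noteq> {}"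
    and M: "\<And>\<delta>. 0 < \<delta> \<Longrightarrow> \<delta> \<le> 1 \<Longrightarrow> real (covering_number \<delta> F) \<le> M * \<delta> powr - t"
  shows "upper_box_dim F \<le> ereal t"
proof -
  \<comment> \<open>The scale 1 forces this; positivity of \<open>M\<close> is what lets the
    logarithm of the product split below.\<close>
  have "1 \<le> M"
    using M[of 1] covering_number_ge_1[of 1, OF _ assms(1)] by simp
  have "filterlim (\<lambda>\<delta>::real. - ln \<delta>) at_top (at_right 0)"
    using ln_at_0 by (simp add: filterlim_uminus_at_top)
  then have "((\<lambda>\<delta>. ln M / - ln \<delta> + t) \<longlongrightarrow> 0 + t) (at_right 0)"
    by (intro tendsto_add tendsto_const tendsto_divide_0[OF tendsto_const]
        filterlim_at_top_imp_at_infinity)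
  then have lim: "Limsup (at_right 0) (\<lambda>\<delta>. ereal (ln M / - ln \<delta> + t)) = ereal t"
    by (intro lim_imp_Limsup) auto
  have "upper_box_dim F \<le> Limsup (at_right 0) (\<lambda>\<delta>. ereal (ln M / - ln \<delta> + t))"
    unfolding upper_box_dim_def
  proof (rule Limsup_mono)
    show "\<forall>\<^sub>F \<delta> in at_right 0. ereal (ln (real (covering_number \<delta> F)) / - ln \<delta>)
            \<le> ereal (ln M / - ln \<delta> + t)"
      using eventually_at_right_0_less_1
    proof eventually_elim
      case (elim \<delta>)
      then have "1 \<le> covering_number \<delta> F" using covering_number_ge_1 assms(1) by auto
      then have "ln (real (covering_number \<delta> F)) \<le> ln (M * \<delta> powr - t)"
        using M[of \<delta>] elim by simp
      also have "\<dots> = ln M - t * ln \<delta>"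
        using \<open>1 \<le> M\<close> elim by (simp add: ln_mult ln_powr)
      finally have "ln (real (covering_number \<delta> F)) / - ln \<delta> \<le> (ln M - t * ln \<delta>) / - ln \<delta>"
        using elim by (intro divide_right_mono) auto
      also have "\<dots> = ln M / - ln \<delta> + t" using elim by (simp add: field_simps)
      finally show ?case by simp
    qed
  qed
  with lim show ?thesis by simp
qed

text \<open>Strict inequality gives the bound with constant 1 at all small scales. The remaining
  scales stay above some \<open>a\<close>, where the covering number is at most its value at
  \<open>a\<close> and \<delta> to the power -t is at least 1.\<close>

lemma upper_box_dim_lessD:
  fixes F :: "'a set"
  assumes "upper_box_dim F < ereal t" "0 \<le> t"
  obtains K where "0 \<le> K"
    "\<And>\<delta>. 0 < \<delta> \<Longrightarrow> \<delta> \<le> 1 \<Longrightarrow> real (covering_number \<delta> F) \<le> K * \<delta> powr - t"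
proof -
  have "\<forall>\<^sub>F \<delta> in at_right 0. ereal (ln (real (covering_number \<delta> F)) / - ln \<delta>) < ereal t"
    using assms(1) unfolding upper_box_dim_def by (rule Limsup_lessD)
  then obtain b where b: "0 < b"
      "\<And>\<delta>. 0 < \<delta> \<Longrightarrow> \<delta> < b \<Longrightarrow> ln (real (covering_number \<delta> F)) / - ln \<delta> < t"
    unfolding eventually_at_right_field by auto
  \<comment> \<open>Lying below 1 as well as below \<open>b\<close> keeps \<open>ln \<delta>\<close>
    negative for all scales under \<open>a\<close>.\<close>
  define a where "a = min 1 b / 2"
  have a: "0 < a" "a < b" "a < 1" using b(1) by (auto simp: a_def min_def)
  show thesis
  proof (rule that[of "1 + real (covering_number a F)"])
    fix \<delta> :: real assume \<delta>: "0 < \<delta>" "\<delta> \<le> 1"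
    show "real (covering_number \<delta> F) \<le> (1 + real (covering_number a F)) * \<delta> powr - t"
    proof (cases "a \<le> \<delta>")
      case True
      have "1 \<le> \<delta> powr - t"
        using \<delta> assms(2) by (simp add: powr_minus one_le_inverse_iff powr_le1)
      have "real (covering_number \<delta> F) \<le> (1 + real (covering_number a F)) * 1"
        using covering_number_antimono[of a \<delta> F] True a by simp
      also have "\<dots> \<le> (1 + real (covering_number a F)) * \<delta> powr - t"
        using \<open>1 \<le> \<delta> powr - t\<close> by (intro mult_left_mono) auto
      finally show ?thesis .
    next
      case False
      have "real (covering_number \<delta> F) \<le> \<delta> powr - t"
      proof (cases "covering_number \<delta> F = 0")
        case nz: False
        have "ln (real (covering_number \<delta> F)) / - ln \<delta> < t"
          using b(2)[of \<delta>] False a \<delta> by simp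
        then have "ln (real (covering_number \<delta> F)) < - t * ln \<delta>"
          using \<delta> False a by (simp add: field_simps)
        also have "\<dots> = ln (\<delta> powr - t)" using \<delta> by (simp add: ln_powr)
        finally have "real (covering_number \<delta> F) < \<delta> powr - t"
          using nz \<delta> by (subst (asm) ln_less_cancel_iff) auto
        then show ?thesis by simp
      qed simp
      also have "\<dots> \<le> (1 + real (covering_number a F)) * \<delta> powr - t"
        by (simp add: algebra_simps)
      finally show ?thesis .
    qed
  qed simp
qed

end

section \<open>Words\<close>

lemma finite_words [simp]: "finite (words N k)"
proof -
  have "words N k = {w. set w \<subseteq> {1..N} \<and> length w = k}" by (auto simp: words_def)
  then show ?thesis by (simp add: finite_lists_length_eq)
qed

lemma card_words: "card (words N k) = N ^ k"
proof -
  have "words N k = {w. set w \<subseteq> {1..N} \<and> length w = k}" by (auto simp: words_def)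
  then show ?thesis by (simp add: card_lists_length_eq)
qed

text \<open>The cut is determined by the length \<open>k\<close> of the first factor. This
  reindexing turns level sums into products.\<close>

lemma words_add: "bij_betw (\<lambda>(u, v). u @ v) (words N k \<times> words N l) (words N (k + l))"
proof (rule bij_betwI')
  fix x y assume "x \<in> words N k \<times> words N l" "y \<in> words N k \<times> words N l"
  then obtain u v u' v' where "x = (u, v)" "y = (u', v')" "length u = length u'"
    unfolding words_def by force
  then show "((case x of (u, v) \<Rightarrow> u @ v) = (case y of (u, v) \<Rightarrow> u @ v)) = (x = y)"
    by simp
next
  fix w assume w: "w \<in> words N (k + l)"
  then have "take k w \<in> words N k" "drop k w \<in> words N l"
    using set_take_subset[of k w] set_drop_subset[of k w] by (auto simp: words_def)
  then show "\<exists>x\<in>words N k \<times> words N l. w = (case x of (u, v) \<Rightarrow> u @ v)"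
    by (intro bexI[of _ "(take k w, drop k w)"]) auto
qed (auto simp: words_def)

lemma comp_word_append: "comp_word f (u @ v) = comp_word f u \<circ> comp_word f v"
  by (induction u) (auto simp: comp_assoc)

text \<open>Unfolds the covering \<open>m\<close> times: a point outside \<open>C\<close> is
  \<open>f i y\<close>, and \<open>i\<close> is prepended to the word that covers \<open>y\<close>;
  a point of \<open>C\<close> is covered by the empty word.\<close>

lemma subset_comp_word:
  assumes "F \<subseteq> (\<Union>i\<in>{1..N}. f i ` F) \<union> C"
  shows "F \<subseteq> (\<Union>w\<in>words N m. comp_word f w ` F) \<union>
             (\<Union>w\<in>(\<Union>j<m. words N j). comp_word f w ` C)"
proof (induction m)
  case 0
  show ?case by (auto simp: words_def)
next
  case (Suc m)
  show ?case
  proof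
    fix x assume "x \<in> F"
    then consider i y where "i \<in> {1..N}" "y \<in> F" "x = f i y" | "x \<in> C"
      using assms by blast
    then show "x \<in> (\<Union>w\<in>words N (Suc m). comp_word f w ` F) \<union>
                   (\<Union>w\<in>(\<Union>j<Suc m. words N j). comp_word f w ` C)"
    proof cases
      case 1
      from Suc 1(2) consider w z where "w \<in> words N m" "z \<in> F" "y = comp_word f w z"
        | w j z where "j < m" "w \<in> words N j" "z \<in> C" "y = comp_word f w z" by blast
      then show ?thesis
      proof cases
        case (1 w z)
        with \<open>i \<in> {1..N}\<close> \<open>x = f i y\<close> have "i # w \<in> words N (Suc m)" "x = comp_word f (i # w) z"
          by (auto simp: words_def)
        with 1 show ?thesis by blast
      next
        case (2 w j z)
        with \<open>i \<in> {1..N}\<close> \<open>x = f i y\<close> have "i # w \<in> words N (Suc j)" "x = comp_word f (i # w) z"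
          by (auto simp: words_def)
        with 2 show ?thesis by blast
      qed
    next
      case 2
      then have "[] \<in> words N 0" "x = comp_word f [] x" by (auto simp: words_def)
      with 2 show ?thesis by blast
    qed
  qed
qed

section \<open>Systems of bi-Lipschitz contractions\<close>

locale bi_lipschitz_ifs =
  fixes S :: "nat \<Rightarrow> 'a::metric_space \<Rightarrow> 'a" and N :: nat
  assumes compact_space: "compact (UNIV :: 'a set)"
    and N_ge_1: "1 \<le> N"
    and bi_lipschitz: "i \<in> {1..N} \<Longrightarrow> bi_lipschitz_contraction (S i)"
begin

abbreviation L :: "nat list \<Rightarrow> real" where
  "L w \<equiv> Lip_upper (comp_word S w)"

lemma two_points: "\<exists>a b :: 'a. a \<noteq> b"
  using bi_lipschitz_contraction_two_points[OF bi_lipschitz[of 1]] N_ge_1 by simp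

section \<open>Contraction ratios of words\<close>

definition ratio :: real where
  "ratio = Max ((\<lambda>i. Lip_upper (S i)) ` {1..N})"

lemma Lip_upper_le_ratio: "i \<in> {1..N} \<Longrightarrow> Lip_upper (S i) \<le> ratio"
  unfolding ratio_def by (intro Max_ge) auto

lemma ratio_bounds: "0 < ratio" "ratio < 1"
proof -
  have "\<And>i. i \<in> {1..N} \<Longrightarrow> 0 < Lip_upper (S i) \<and> Lip_upper (S i) < 1"
    using bi_lipschitz unfolding bi_lipschitz_contraction_def by (meson less_le_trans)
  moreover have "ratio \<in> (\<lambda>i. Lip_upper (S i)) ` {1..N}"
    unfolding ratio_def using N_ge_1 by (intro Max_in) auto
  ultimately show "0 < ratio" "ratio < 1" by auto
qed

lemma dist_ratio: "i \<in> {1..N} \<Longrightarrow> dist (S i x) (S i y) \<le> ratio * dist x y"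
  by (rule order_trans[OF lipschitz_onD[OF bi_lipschitz_contraction_lipschitz[OF bi_lipschitz]]])
    (simp_all add: Lip_upper_le_ratio mult_right_mono)

lemma dist_comp_word_ratio:
  "w \<in> words N k \<Longrightarrow> dist (comp_word S w x) (comp_word S w y) \<le> ratio ^ k * dist x y"
proof (induction k arbitrary: w)
  case 0
  then show ?case by (simp add: words_def)
next
  case (Suc k)
  then obtain i v where w: "w = i # v" "i \<in> {1..N}" "v \<in> words N k"
    by (cases w) (auto simp: words_def)
  have "dist (comp_word S w x) (comp_word S w y)
        \<le> ratio * dist (comp_word S v x) (comp_word S v y)"
    using dist_ratio[OF w(2)] by (simp add: w(1))
  also have "\<dots> \<le> ratio * (ratio ^ k * dist x y)"
    using Suc.IH[OF w(3)] ratio_bounds by (intro mult_left_mono) auto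
  finally show ?case by (simp add: mult.assoc)
qed

lemma dist_comp_word:
  assumes "w \<in> words N k"
  shows "dist (comp_word S w x) (comp_word S w y) \<le> L w * dist x y"
proof (rule Lip_upper_bound)
  show "(ratio ^ k)-lipschitz_on UNIV (comp_word S w)"
    using dist_comp_word_ratio[OF assms] ratio_bounds by (intro lipschitz_onI) auto
qed

lemma L_le_ratio:
  assumes "w \<in> words N k"
  shows "L w \<le> ratio ^ k"
proof -
  obtain a b :: 'a where "a \<noteq> b" using two_points by blast
  then show ?thesis by (rule Lip_upper_least) (rule dist_comp_word_ratio[OF assms])
qed

lemma inj_comp_word: "w \<in> words N k \<Longrightarrow> inj (comp_word S w)"
proof (induction w arbitrary: k)
  case (Cons i w)
  then have "i \<in> {1..N}" "w \<in> words N (length w)" by (auto simp: words_def)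
  then show ?case
    using Cons.IH bi_lipschitz_contraction_inj[OF bi_lipschitz]
    unfolding comp_word.simps by (intro inj_compose) blast+
qed simp

text \<open>Injectivity keeps the images of two distinct points apart.\<close>

lemma L_pos:
  assumes "w \<in> words N k"
  shows "0 < L w"
proof -
  obtain a b :: 'a where "a \<noteq> b" using two_points by blast
  then have "0 < dist (comp_word S w a) (comp_word S w b)"
    using inj_comp_word[OF assms] by (auto dest: injD)
  also have "\<dots> \<le> L w * dist a b" by (rule dist_comp_word[OF assms])
  finally show ?thesis by (simp add: zero_less_mult_iff)
qed

lemma L_less_1:
  assumes "w \<in> words N k" "0 < k"
  shows "L w < 1"
  using L_le_ratio[OF assms(1)] ratio_bounds power_Suc_less_one[of ratio "k - 1"] assms(2) by simp

lemma L_append: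
  assumes "u \<in> words N k" "v \<in> words N l"
  shows "L (u @ v) \<le> L u * L v"
proof -
  obtain a b :: 'a where ab: "a \<noteq> b" using two_points by blast
  show ?thesis
  proof (rule Lip_upper_least[OF ab])
    fix x y
    have "dist (comp_word S (u @ v) x) (comp_word S (u @ v) y)
          \<le> L u * dist (comp_word S v x) (comp_word S v y)"
      using dist_comp_word[OF assms(1)] by (simp add: comp_word_append)
    also have "\<dots> \<le> L u * (L v * dist x y)"
      using dist_comp_word[OF assms(2)] L_pos[OF assms(1)] by (intro mult_left_mono) auto
    finally show "dist (comp_word S (u @ v) x) (comp_word S (u @ v) y) \<le> L u * L v * dist x y"
      by (simp add: mult.assoc)
  qed
qed

subsection \<open>The upper Lipschitz dimension\<close>

definition level_sum :: "nat \<Rightarrow> real \<Rightarrow> real" where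
  "level_sum k t = (\<Sum>w\<in>words N k. L w powr t)"

lemma words_nonempty: "words N k \<noteq> {}"
  using card_words[of N k] N_ge_1 by auto

lemma L_nonzero: "w \<in> words N k \<Longrightarrow> L w \<noteq> 0"
  using L_pos by fastforce

lemma level_sum_pos: "0 < level_sum k t"
  unfolding level_sum_def by (rule sum_pos) (simp_all add: words_nonempty L_nonzero)

lemma level_sum_0: "1 \<le> level_sum k 0"
proof -
  have "level_sum k 0 = (\<Sum>w\<in>words N k. 1)"
    \<comment> \<open>\<open>L_nonzero\<close> matters here, because
      \<open>0 powr 0 = 0\<close>.\<close>
    unfolding level_sum_def by (rule sum.cong) (simp_all add: L_nonzero)
  also have "\<dots> = real N ^ k" by (simp add: card_words)
  finally show ?thesis using N_ge_1 by simp
qed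

lemma level_sum_strict_antimono:
  assumes "0 < k" "t < u"
  shows "level_sum k u < level_sum k t"
  unfolding level_sum_def
proof (rule sum_strict_mono)
  fix w assume "w \<in> words N k"
  then show "L w powr u < L w powr t"
    using L_pos L_less_1 assms by (intro powr_less_mono') auto
qed (simp_all add: words_nonempty)

lemma level_sum_tendsto_0:
  assumes "0 < k"
  shows "(level_sum k \<longlongrightarrow> 0) at_top"
proof -
  have "((\<lambda>t. \<Sum>w\<in>words N k. L w powr t) \<longlongrightarrow> (\<Sum>w\<in>words N k. 0)) at_top"
  proof (rule tendsto_sum)
    fix w assume w: "w \<in> words N k"
    then have "0 < L w" "ln (L w) < 0" using L_pos L_less_1 assms by auto
    then have "filterlim (\<lambda>t. t * ln (L w)) at_bot at_top"
      using filterlim_tendsto_neg_mult_at_bot[OF tendsto_const _ filterlim_ident, of "ln (L w)"]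
      by (simp add: mult.commute[of _ "ln (L w)"])
    then have "((\<lambda>t. exp (t * ln (L w))) \<longlongrightarrow> 0) at_top"
      by (rule filterlim_compose[OF exp_at_bot])
    then show "((\<lambda>t. L w powr t) \<longlongrightarrow> 0) at_top"
      using \<open>0 < L w\<close> by (simp add: powr_def)
  qed
  then show ?thesis unfolding level_sum_def by simp
qed

text \<open>Justifies the \<open>THE\<close> in \<open>level_exponent\<close>: the sum is at least 1
  at exponent 0 and below 1 at large exponents, so a solution exists by the intermediate value
  theorem, and strict monotonicity makes it unique.\<close>

lemma level_sum_level_exponent:
  assumes "0 < k"
  shows "level_sum k (level_exponent N S k) = 1"
proof -
  have "\<forall>\<^sub>F t in at_top. level_sum k t < 1"
    using order_tendstoD(2)[OF level_sum_tendsto_0[OF assms], of 1] by simp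
  then have "\<forall>\<^sub>F t in at_top. 0 \<le> t \<and> level_sum k t < 1"
    using eventually_ge_at_top[of 0] by eventually_elim auto
  then obtain T where T: "0 \<le> T" "level_sum k T < 1"
    unfolding eventually_at_top_linorder by auto
  have "continuous_on {0..T} (level_sum k)"
    unfolding level_sum_def using L_nonzero
    by (intro continuous_intros) auto
  then obtain t where t: "level_sum k t = 1"
    using IVT2'[of "level_sum k" T 1 0] T level_sum_0 by auto
  moreover have "u = t" if "level_sum k u = 1" for u
    using that t level_sum_strict_antimono[OF assms, of t u]
      level_sum_strict_antimono[OF assms, of u t] by (cases u t rule: linorder_cases) auto
  ultimately have "\<exists>!t. level_sum k t = 1" by blast
  then show ?thesis
    using theI'[of "\<lambda>t. level_sum k t = 1"] by (simp add: level_exponent_def level_sum_def)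
qed

lemma level_sum_less_1_iff:
  assumes "0 < k"
  shows "level_sum k t < 1 \<longleftrightarrow> level_exponent N S k < t"
  using level_sum_level_exponent[OF assms]
    level_sum_strict_antimono[OF assms, of t "level_exponent N S k"]
    level_sum_strict_antimono[OF assms, of "level_exponent N S k" t]
  by (cases t "level_exponent N S k" rule: linorder_cases) auto

lemma level_exponent_nonneg:
  assumes "0 < k"
  shows "0 \<le> level_exponent N S k"
  using level_sum_less_1_iff[OF assms, of 0] level_sum_0[of k] by simp

text \<open>Submultiplicativity is inherited from \<open>L_append\<close>; \<open>t \<ge> 0\<close>
  makes the power monotone in its base.\<close>

lemma level_sum_add:
  assumes "0 \<le> t"
  shows "level_sum (k + l) t \<le> level_sum k t * level_sum l t"
proof -
  have "level_sum (k + l) t = (\<Sum>(u, v)\<in>words N k \<times> words N l. L (u @ v) powr t)"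
    unfolding level_sum_def
    by (subst sum.reindex_bij_betw[OF words_add, symmetric]) (simp add: case_prod_unfold)
  also have "\<dots> \<le> (\<Sum>(u, v)\<in>words N k \<times> words N l. L u powr t * L v powr t)"
  proof (rule sum_mono)
    fix x assume "x \<in> words N k \<times> words N l"
    then obtain u v where x: "x = (u, v)" and u: "u \<in> words N k" and v: "v \<in> words N l" by blast
    have "u @ v \<in> words N (k + l)" using u v by (auto simp: words_def)
    then have "L (u @ v) powr t \<le> (L u * L v) powr t"
      using L_append[OF u v] L_pos assms by (intro powr_mono2) (auto intro: less_imp_le)
    also have "\<dots> = L u powr t * L v powr t"
      using L_pos[OF u] L_pos[OF v] by (simp add: powr_mult)
    finally show "(case x of (u, v) \<Rightarrow> L (u @ v) powr t)
        \<le> (case x of (u, v) \<Rightarrow> L u powr t * L v powr t)" by (simp add: x)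
  qed
  also have "\<dots> = level_sum k t * level_sum l t"
    unfolding level_sum_def by (simp add: sum_product sum.cartesian_product)
  finally show ?thesis .
qed

lemma level_sum_mult_add:
  assumes "0 \<le> t"
  shows "level_sum (q * m + r) t \<le> level_sum m t ^ q * level_sum r t"
proof (induction q)
  case (Suc q)
  have "level_sum (Suc q * m + r) t \<le> level_sum m t * level_sum (q * m + r) t"
    using level_sum_add[OF assms, of m "q * m + r"] by (simp add: add.assoc)
  also have "\<dots> \<le> level_sum m t * (level_sum m t ^ q * level_sum r t)"
    using Suc level_sum_pos[of m t] by (intro mult_left_mono) auto
  finally show ?case by (simp add: mult.assoc)
qed simp

text \<open>Dividing \<open>k\<close> by \<open>m\<close> with remainder bounds the sum at level
  \<open>k\<close> by a high power of a number below 1 times one of finitely many remainder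
  sums.\<close>

lemma eventually_level_exponent_less:
  assumes "0 < m" "level_exponent N S m < t"
  shows "\<forall>\<^sub>F k in sequentially. level_exponent N S k < t"
proof -
  have "0 \<le> t" using level_exponent_nonneg[OF assms(1)] assms(2) by simp
  \<comment> \<open>Dominates the level sums of all remainders at once, since every summand is
    positive.\<close>
  define B where "B = (\<Sum>r<m. level_sum r t)"
  have "level_sum m t < 1" using level_sum_less_1_iff[OF assms(1)] assms(2) by simp
  then have "(\<lambda>q. level_sum m t ^ q * B) \<longlonglongrightarrow> 0 * B"
    using level_sum_pos[of m t] by (intro tendsto_intros LIMSEQ_power_zero) auto
  then have "\<forall>\<^sub>F q in sequentially. level_sum m t ^ q * B < 1"
    by (intro order_tendstoD(2)[where a = 1]) auto
  then obtain Q where Q: "\<And>q. Q \<le> q \<Longrightarrow> level_sum m t ^ q * B < 1"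
    unfolding eventually_sequentially by blast
  show ?thesis unfolding eventually_sequentially
  proof (intro exI allI impI)
    \<comment> \<open>\<open>Suc\<close> also excludes \<open>k = 0\<close>, where the exponent is
      meaningless, in case \<open>Q = 0\<close>.\<close>
    fix k assume k: "Suc Q * m \<le> k"
    have "level_sum k t \<le> level_sum m t ^ (k div m) * level_sum (k mod m) t"
      using level_sum_mult_add[OF \<open>0 \<le> t\<close>, of "k div m" m "k mod m"] by simp
    also have "\<dots> \<le> level_sum m t ^ (k div m) * B"
      unfolding B_def using assms(1) level_sum_pos
      by (intro mult_left_mono member_le_sum) (auto intro: less_imp_le)
    also have "\<dots> < 1"
      using k assms(1) by (intro Q) (simp add: less_eq_div_iff_mult_less_eq)
    finally show "level_exponent N S k < t"
      using level_sum_less_1_iff[of k t] k assms(1) by (cases k) auto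
  qed
qed

text \<open>Needed to give the \<open>lim\<close> in \<open>upper_Lipschitz_dim\<close> its meaning.
  The argument is of Fekete type, with the infimum taken over positive levels only.\<close>

lemma level_exponent_convergent: "convergent (level_exponent N S)"
proof -
  define s where "s = Inf (level_exponent N S ` {0<..})"
  have bdd: "bdd_below (level_exponent N S ` {0<..})"
    using level_exponent_nonneg by (intro bdd_belowI[of _ 0]) auto
  have "level_exponent N S \<longlonglongrightarrow> s"
  proof (rule order_tendstoI)
    fix a assume "a < s"
    have "s \<le> level_exponent N S k" if "0 < k" for k
      unfolding s_def using bdd that by (intro cInf_lower) auto
    with \<open>a < s\<close> have "a < level_exponent N S k" if "0 < k" for k
      using that less_le_trans by blast
    then show "\<forall>\<^sub>F k in sequentially. a < level_exponent N S k"
      by (rule eventually_mono[OF eventually_gt_at_top])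
  next
    fix a assume "s < a"
    then obtain m where "0 < m" "level_exponent N S m < a"
      unfolding s_def using cInf_lessD[of "level_exponent N S ` {0<..}" a] by auto
    then show "\<forall>\<^sub>F k in sequentially. level_exponent N S k < a"
      by (rule eventually_level_exponent_less)
  qed
  then show ?thesis by (rule convergentI)
qed

text \<open>Supplies the level at which the covering recursion contracts.\<close>

lemma upper_Lipschitz_dim_lessD:
  assumes "upper_Lipschitz_dim N S < t"
  shows "0 \<le> t" "\<exists>m>0. level_sum m t < 1"
proof -
  have "level_exponent N S \<longlonglongrightarrow> upper_Lipschitz_dim N S"
    using level_exponent_convergent unfolding upper_Lipschitz_dim_def convergent_LIMSEQ_iff .
  then have "\<forall>\<^sub>F k in sequentially. level_exponent N S k < t"
    using assms by (rule order_tendstoD)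
  then have "\<forall>\<^sub>F k in sequentially. 0 < k \<and> level_exponent N S k < t"
    using eventually_gt_at_top[of 0] by eventually_elim auto
  then obtain m where "0 < m" "level_exponent N S m < t"
    unfolding eventually_sequentially by auto
  then show "0 \<le> t" "\<exists>m>0. level_sum m t < 1"
    using level_exponent_nonneg[of m] level_sum_less_1_iff[of m t] by auto
qed

subsection \<open>Attractors\<close>

lemma continuous_on_S: "i \<in> {1..N} \<Longrightarrow> continuous_on A (S i)"
  by (rule continuous_on_subset[OF lipschitz_on_continuous_on[OF
        bi_lipschitz_contraction_lipschitz[OF bi_lipschitz]]]) auto

text \<open>At a point \<open>x\<close> of \<open>F\<close> farthest from \<open>G\<close>, either
  \<open>x\<close> lies in \<open>C\<close> and hence in \<open>G\<close>, or
  \<open>x = S i y\<close> and its distance to \<open>G\<close> is at most \<open>ratio\<close>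
  times that of \<open>y\<close>, hence at most \<open>ratio\<close> times itself.\<close>

lemma subset_invariant:
  assumes F: "compact F" "F \<subseteq> (\<Union>i\<in>{1..N}. S i ` F) \<union> C"
    and G: "closed G" "G \<noteq> {}" "(\<Union>i\<in>{1..N}. S i ` G) \<union> C \<subseteq> G"
  shows "F \<subseteq> G"
proof (cases "F = {}")
  case False
  have "continuous_on F (\<lambda>x. infdist x G)" by (intro continuous_intros)
  with False obtain x where x: "x \<in> F" "\<And>y. y \<in> F \<Longrightarrow> infdist y G \<le> infdist x G"
    using continuous_attains_sup[OF F(1)] by blast
  have "infdist x G = 0"
  proof (cases "x \<in> C")
    case True
    then show ?thesis using G by auto
  next
    case False
    then obtain i y where i: "i \<in> {1..N}" and y: "y \<in> F" "x = S i y" using x F by blast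
    have "infdist x G \<le> ratio * infdist y G"
    proof -
      \<comment> \<open>Division by \<open>ratio\<close> moves the constant out of the way, so that
        the infimum over \<open>z\<close> can be taken.\<close>
      have "infdist x G / ratio \<le> infdist y G"
        unfolding infdist_notempty[OF G(2), of y]
      proof (rule cINF_greatest[OF G(2)])
        fix z assume "z \<in> G"
        then have "S i z \<in> G" using G i by blast
        then have "infdist x G \<le> ratio * dist y z"
          using infdist_le[of "S i z" G x] dist_ratio[OF i, of y z] y by simp
        then show "infdist x G / ratio \<le> dist y z"
          using ratio_bounds by (simp add: field_simps)
      qed
      then show ?thesis using ratio_bounds by (simp add: field_simps)
    qed
    also have "\<dots> \<le> ratio * infdist x G"
      using x y ratio_bounds by (intro mult_left_mono) auto
    finally have "(1 - ratio) * infdist x G \<le> 0" by (simp add: algebra_simps)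
    then show ?thesis
      using ratio_bounds infdist_nonneg[of x G] by (simp add: mult_le_0_iff)
  qed
  then have "infdist y G = 0" if "y \<in> F" for y
    using x(2)[OF that] infdist_nonneg[of y G] by simp
  then show ?thesis using G in_closed_iff_infdist_zero by blast
qed simp

text \<open>The invariant set is the intersection of the decreasing compact sets obtained by
  iterating \<Phi> from the whole space.\<close>

lemma invariant_set_exists:
  assumes "compact C"
  shows "\<exists>F. F \<noteq> {} \<and> compact F \<and> F = (\<Union>i\<in>{1..N}. S i ` F) \<union> C"
proof -
  define \<Phi> where "\<Phi> F = (\<Union>i\<in>{1..N}. S i ` F) \<union> C" for F
  define K where "K n = (\<Phi> ^^ n) UNIV" for n
  have K_Suc: "K (Suc n) = \<Phi> (K n)" for n by (simp add: K_def)
  have mono: "\<Phi> A \<subseteq> \<Phi> B" if "A \<subseteq> B" for A B using that unfolding \<Phi>_def by blast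
  have comp: "compact (K n) \<and> K n \<noteq> {}" for n
  proof (induction n)
    case 0
    show ?case using compact_space by (simp add: K_def)
  next
    case (Suc n)
    have "compact (\<Phi> (K n))" unfolding \<Phi>_def using Suc assms continuous_on_S
      by (intro compact_Un compact_UN compact_continuous_image) auto
    \<comment> \<open>\<open>N \<ge> 1\<close> keeps the iterates non-empty even if \<open>C\<close>
      is empty.\<close>
    moreover have "S 1 ` K n \<subseteq> \<Phi> (K n)" unfolding \<Phi>_def using N_ge_1 by force
    ultimately show ?case using Suc by (auto simp: K_Suc)
  qed
  have dec1: "K (Suc n) \<subseteq> K n" for n
  proof (induction n)
    case (Suc n)
    then show ?case using mono K_Suc by metis
  qed (simp add: K_def)
  have dec: "K n \<subseteq> K m" if "m \<le> n" for m n
    using lift_Suc_antimono_le[of K, OF dec1 that] .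
  define F where "F = (\<Inter>n. K n)"
  have "UNIV \<inter> F \<noteq> {}" unfolding F_def
  proof (rule compact_imp_fip_image[OF compact_space])
    fix I :: "nat set" assume I: "finite I"
    \<comment> \<open>The sum is a stage beyond every index in \<open>I\<close>, also meaningful for
      empty \<open>I\<close>.\<close>
    have "K (\<Sum>I) \<subseteq> K n" if "n \<in> I" for n
      using dec member_le_sum[OF that, of "\<lambda>n. n"] I by simp
    then show "UNIV \<inter> \<Inter> (K ` I) \<noteq> {}" using comp[of "\<Sum>I"] by blast
  qed (use comp in \<open>auto intro: compact_imp_closed\<close>)
  then have "F \<noteq> {}" by simp
  moreover have "compact F"
    proof -
    have "closed F" unfolding F_def using comp by (intro closed_INT ballI compact_imp_closed) blast
    then show ?thesis using compact_Int_closed[OF compact_space, of F] by simp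
  qed
  moreover have "\<Phi> F \<subseteq> F"
  proof -
    have "\<Phi> F \<subseteq> K n" for n
    proof -
      have "\<Phi> F \<subseteq> \<Phi> (K n)" by (rule mono) (auto simp: F_def)
      then show ?thesis using dec1[of n] by (simp add: K_Suc)
    qed
    then show ?thesis unfolding F_def by blast
  qed
  moreover have "F \<subseteq> \<Phi> F"
  proof
    fix x assume x: "x \<in> F"
    show "x \<in> \<Phi> F"
    proof (rule ccontr)
      assume neg: "x \<notin> \<Phi> F"
      \<comment> \<open>By injectivity each map contributes at most one preimage of \<open>x\<close>, which leaves the
        decreasing sets \<open>K n\<close> from some stage on.\<close>
      have "\<exists>n. x \<notin> S i ` K n" if i: "i \<in> {1..N}" for i
      proof (rule ccontr)
        assume "\<not> ?thesis"
        then have all: "x \<in> S i ` K n" for n by blast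
        then obtain y where y: "x = S i y" by blast
        have "inj (S i)" by (rule bi_lipschitz_contraction_inj[OF bi_lipschitz[OF i]])
        then have "y \<in> K n" for n using all[of n] y by (auto dest: injD)
        then have "y \<in> F" by (simp add: F_def)
        then show False using neg y i by (auto simp: \<Phi>_def)
      qed
      then obtain n where n: "\<And>i. i \<in> {1..N} \<Longrightarrow> x \<notin> S i ` K (n i)" by metis
      define m where "m = (\<Sum>i\<in>{1..N}. n i)"
      have "x \<notin> S i ` K m" if "i \<in> {1..N}" for i
      proof -
        have "n i \<le> m" unfolding m_def using that by (intro member_le_sum) auto
        then show ?thesis using dec n[OF that] by blast
      qed
      moreover have "x \<in> \<Phi> (K m)" using x unfolding F_def K_Suc[symmetric] by blast
      ultimately have "x \<in> C" by (auto simp: \<Phi>_def)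
      then show False using neg by (simp add: \<Phi>_def)
    qed
  qed
  ultimately show ?thesis unfolding \<Phi>_def by (intro exI[of _ F]) blast
qed

lemma attractor_props:
  assumes "compact C"
  shows "attractor N S C \<noteq> {}" "compact (attractor N S C)"
    "attractor N S C = (\<Union>i\<in>{1..N}. S i ` attractor N S C) \<union> C"
proof -
  let ?P = "\<lambda>F. F \<noteq> {} \<and> compact F \<and> F = (\<Union>i\<in>{1..N}. S i ` F) \<union> C"
  have "\<exists>!F. ?P F"
  proof (rule ex_ex1I)
    fix F G assume "?P F" "?P G"
    then show "F = G"
      using subset_invariant[of F C G] subset_invariant[of G C F] compact_imp_closed
      by (metis order_refl subset_antisym)
  qed (rule invariant_set_exists[OF assms])
  then have "?P (attractor N S C)" unfolding attractor_def by (rule theI')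
  then show "attractor N S C \<noteq> {}" "compact (attractor N S C)"
    "attractor N S C = (\<Union>i\<in>{1..N}. S i ` attractor N S C) \<union> C" by blast+
qed

text \<open>The larger attractor contains its own images, so it is an admissible \<open>G\<close>
  for the empty condensation set.\<close>

lemma attractor_empty_subset:
  assumes "compact C"
  shows "attractor N S {} \<subseteq> attractor N S C"
proof (rule subset_invariant[where C = "{}"])
  show "attractor N S {} \<subseteq> (\<Union>i\<in>{1..N}. S i ` attractor N S {}) \<union> {}"
    using attractor_props(3)[of "{}"] by simp
  show "(\<Union>i\<in>{1..N}. S i ` attractor N S C) \<union> {} \<subseteq> attractor N S C"
    using attractor_props(3)[OF assms] by blast
qed (use attractor_props(1,2) assms in \<open>auto intro: compact_imp_closed\<close>)

subsection \<open>The upper bound\<close>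

lemma covering_number_recursion:
  assumes "0 < \<delta>" "F \<subseteq> (\<Union>i\<in>{1..N}. S i ` F) \<union> C"
  shows "covering_number \<delta> F \<le> (\<Sum>w\<in>words N m. covering_number (\<delta> / L w) F) +
           card (\<Union>j<m. words N j) * covering_number \<delta> C"
proof -
  let ?V = "\<Union>j<m. words N j"
  have fin: "finite ?V" by simp
  note cov = covering_number_mono[OF compact_space assms(1)]
    covering_number_Un[OF compact_space assms(1)] covering_number_UN[OF compact_space assms(1)]
    covering_number_image[OF compact_space assms(1)]
  have "covering_number \<delta> F \<le> covering_number \<delta> (\<Union>w\<in>words N m. comp_word S w ` F) +
      covering_number \<delta> (\<Union>w\<in>?V. comp_word S w ` C)"
    using cov(1)[OF subset_comp_word[OF assms(2), of m]] cov(2) by (rule order_trans)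
  also have "covering_number \<delta> (\<Union>w\<in>words N m. comp_word S w ` F)
      \<le> (\<Sum>w\<in>words N m. covering_number \<delta> (comp_word S w ` F))"
    by (intro cov(3)) simp
  also have "\<dots> \<le> (\<Sum>w\<in>words N m. covering_number (\<delta> / L w) F)"
    using L_pos dist_comp_word by (intro sum_mono cov(4)) auto
  also have "covering_number \<delta> (\<Union>w\<in>?V. comp_word S w ` C)
      \<le> (\<Sum>w\<in>?V. covering_number \<delta> (comp_word S w ` C))"
    by (intro cov(3) fin)
  also have "\<dots> \<le> (\<Sum>w\<in>?V. covering_number \<delta> C)"
  proof (rule sum_mono)
    fix w assume "w \<in> ?V"
    then obtain j where w: "w \<in> words N j" by blast
    \<comment> \<open>The crude constant 1 covers every word, including the empty one, so each copy
      of \<open>C\<close> costs no more than \<open>C\<close> itself.\<close>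
    have "dist (comp_word S w x) (comp_word S w y) \<le> 1 * dist x y" for x y
      using dist_comp_word_ratio[OF w, of x y] ratio_bounds
        mult_right_mono[of "ratio ^ j" 1 "dist x y"] power_le_one[of ratio j] by simp
    from cov(4)[OF zero_less_one this]
    show "covering_number \<delta> (comp_word S w ` C) \<le> covering_number \<delta> C" by simp
  qed
  also have "\<dots> = card ?V * covering_number \<delta> C" by simp
  finally show ?thesis by simp
qed

text \<open>Induction on \<open>n\<close> over the scales at least \<open>ratio ^ n\<close>: one use
  of the recursion passes from \<delta> to scales \<open>\<delta> / L w\<close>, larger by a factor
  of at least \<open>1 / ratio\<close>.\<close>

lemma covering_number_bound:
  assumes F: "F \<subseteq> (\<Union>i\<in>{1..N}. S i ` F) \<union> C"
    and m: "0 < m" "level_sum m t < 1" and t: "0 \<le> t"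
    and C: "0 \<le> K" "\<And>\<delta>. 0 < \<delta> \<Longrightarrow> \<delta> \<le> 1 \<Longrightarrow> real (covering_number \<delta> C) \<le> K * \<delta> powr - t"
  obtains M where
    "\<And>\<delta>. 0 < \<delta> \<Longrightarrow> \<delta> \<le> 1 \<Longrightarrow> real (covering_number \<delta> F) \<le> M * \<delta> powr - t"
proof -
  \<comment> \<open>For \<delta> below the smallest ratio, all the scales
    \<open>\<delta> / L w\<close> stay below 1, within reach of the induction hypothesis.\<close>
  define a where "a = Min (L ` words N m)"
  have fin: "finite (L ` words N m)" "L ` words N m \<noteq> {}" using words_nonempty by auto
  have a: "0 < a" "\<And>w. w \<in> words N m \<Longrightarrow> a \<le> L w"
    unfolding a_def using fin L_pos by (auto simp: Min_gr_iff)
  define K' where "K' = real (card (\<Union>j<m. words N j)) * K"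
  \<comment> \<open>The first summand handles scales above \<open>a\<close>; the second makes
    \<open>M\<close> survive the recursion, as \<open>M1\<close> records.\<close>
  define M where "M = real (covering_number a F) + K' / (1 - level_sum m t)"
  have "0 \<le> K'" using C by (simp add: K'_def)
  then have M0: "real (covering_number a F) \<le> M" "0 \<le> M"
    using m by (auto simp: M_def)
  have "K' / (1 - level_sum m t) \<le> M" by (simp add: M_def)
  then have M1: "M * level_sum m t + K' \<le> M"
    using m by (simp add: field_simps)
  have bound: "real (covering_number \<delta> F) \<le> M * \<delta> powr - t"
    if "0 < \<delta>" "\<delta> \<le> 1" "ratio ^ n \<le> \<delta>" for n \<delta>
    using that
  proof (induction n arbitrary: \<delta> rule: nat_induct)
    case (0 \<delta>)
    then have "\<delta> = 1" by simp
    obtain w where w: "w \<in> words N m" using words_nonempty by blast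
    have "a \<le> 1" using a(2)[OF w] L_less_1[OF w m(1)] by simp
    with \<open>\<delta> = 1\<close> show ?case
      using covering_number_antimono[OF compact_space a(1), of 1 F] M0 by simp
  next
    case (Suc n \<delta>)
    show ?case
    proof (cases "a \<le> \<delta>")
      case True
      have "1 \<le> \<delta> powr - t"
        using Suc.prems t by (simp add: powr_minus one_le_inverse_iff powr_le1)
      then have "M * 1 \<le> M * \<delta> powr - t" using M0 by (intro mult_left_mono) auto
      moreover have "covering_number \<delta> F \<le> covering_number a F"
        by (rule covering_number_antimono[OF compact_space a(1) True])
      ultimately show ?thesis using M0 by simp
    next
      case False
      have step: "real (covering_number (\<delta> / L w) F) \<le> M * (\<delta> powr - t * L w powr t)"
        if w: "w \<in> words N m" for w
      proof -
        have "L w \<le> ratio ^ m" by (rule L_le_ratio[OF w])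
        also have "\<dots> \<le> ratio ^ 1" using ratio_bounds m by (intro power_decreasing) auto
        finally have "L w * ratio ^ n \<le> ratio ^ Suc n"
          using ratio_bounds by (simp add: mult_right_mono)
        also have "\<dots> \<le> \<delta>" by (rule Suc.prems)
        finally have "ratio ^ n \<le> \<delta> / L w" using L_pos[OF w] by (simp add: field_simps)
        moreover have "\<delta> / L w \<le> 1" using False a(2)[OF w] L_pos[OF w] by simp
        moreover have "0 < \<delta> / L w" using L_pos[OF w] Suc.prems by simp
        ultimately have "real (covering_number (\<delta> / L w) F) \<le> M * (\<delta> / L w) powr - t"
          using Suc.IH by blast
        also have "(\<delta> / L w) powr - t = \<delta> powr - t * L w powr t"
          using L_pos[OF w] Suc.prems by (simp add: powr_divide powr_minus divide_simps)
        finally show ?thesis .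
      qed
      have "real (covering_number \<delta> F) \<le> real ((\<Sum>w\<in>words N m. covering_number (\<delta> / L w) F) +
           card (\<Union>j<m. words N j) * covering_number \<delta> C)"
        using covering_number_recursion[OF Suc.prems(1) F, of m] by (rule of_nat_mono)
      also have "\<dots> = (\<Sum>w\<in>words N m. real (covering_number (\<delta> / L w) F)) +
           real (card (\<Union>j<m. words N j)) * real (covering_number \<delta> C)" by simp
      also have "\<dots> \<le> (\<Sum>w\<in>words N m. M * (\<delta> powr - t * L w powr t)) +
           real (card (\<Union>j<m. words N j)) * (K * \<delta> powr - t)"
        using step C(2)[OF Suc.prems(1,2)] by (intro add_mono sum_mono mult_left_mono) auto
      also have "\<dots> = (M * level_sum m t + K') * \<delta> powr - t"
        by (simp add: level_sum_def K'_def sum_distrib_left sum_distrib_right algebra_simps)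
      also have "\<dots> \<le> M * \<delta> powr - t" using M1 by (intro mult_right_mono) auto
      finally show ?thesis .
    qed
  qed
  show thesis
  proof (rule that)
    fix \<delta> :: real assume \<delta>: "0 < \<delta>" "\<delta> \<le> 1"
    obtain n where "ratio ^ n < \<delta>" using real_arch_pow_inv[OF \<delta>(1) ratio_bounds(2)] by blast
    then show "real (covering_number \<delta> F) \<le> M * \<delta> powr - t"
      using bound[OF \<delta>, of n] by simp
  qed
qed

text \<open>Arguing by contradiction with a real \<open>t\<close> strictly between the two sides
  treats finite and infinite dimensions alike.\<close>

lemma upper_box_dim_attractor_le:
  assumes "compact C"
  shows "upper_box_dim (attractor N S C)
           \<le> max (ereal (upper_Lipschitz_dim N S)) (upper_box_dim C)"
proof (rule ccontr)
  assume "\<not> ?thesis"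
  then obtain t where t: "max (ereal (upper_Lipschitz_dim N S)) (upper_box_dim C) < ereal t"
      "ereal t < upper_box_dim (attractor N S C)"
    using ereal_dense2 by (meson not_le)
  then have "upper_Lipschitz_dim N S < t" "upper_box_dim C < ereal t" by auto
  note tm = upper_Lipschitz_dim_lessD[OF this(1)]
  then obtain m where m: "0 < m" "level_sum m t < 1" by blast
  obtain K where K: "0 \<le> K"
      "\<And>\<delta>. 0 < \<delta> \<Longrightarrow> \<delta> \<le> 1 \<Longrightarrow> real (covering_number \<delta> C) \<le> K * \<delta> powr - t"
    using upper_box_dim_lessD[OF compact_space \<open>upper_box_dim C < ereal t\<close> tm(1)] by blast
  obtain M where
    "\<And>\<delta>. 0 < \<delta> \<Longrightarrow> \<delta> \<le> 1 \<Longrightarrow> real (covering_number \<delta> (attractor N S C)) \<le> M * \<delta> powr - t"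
    using covering_number_bound[OF equalityD1[OF attractor_props(3)[OF assms]] m tm(1) K] by blast
  then have "upper_box_dim (attractor N S C) \<le> ereal t"
    by (rule upper_box_dim_leI[OF compact_space attractor_props(1)[OF assms]])
  with t(2) show False by simp
qed

end

theorem theorem2p1:
  fixes S :: "nat \<Rightarrow> 'a::metric_space \<Rightarrow> 'a" and N :: nat and C :: "'a set"
  assumes "compact (UNIV :: 'a set)"
    and "iterated_function_system N S"
    and "\<And>i. i \<in> {1..N} \<Longrightarrow> bi_lipschitz_contraction (S i)"
    and "C \<noteq> {}" and "compact C"
  shows "max (upper_box_dim (attractor N S {})) (upper_box_dim C)
           \<le> upper_box_dim (attractor N S C)
       \<and> upper_box_dim (attractor N S C)
           \<le> max (ereal (upper_Lipschitz_dim N S)) (upper_box_dim C)"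
proof -
  interpret bi_lipschitz_ifs S N
    using assms(1-3) by unfold_locales (auto simp: iterated_function_system_def)
  have "C \<subseteq> attractor N S C" using attractor_props(3)[OF assms(5)] by blast
  then have "upper_box_dim C \<le> upper_box_dim (attractor N S C)"
    by (rule upper_box_dim_mono[OF assms(1,4)])
  moreover have "upper_box_dim (attractor N S {}) \<le> upper_box_dim (attractor N S C)"
    using attractor_props(1)[of "{}"] attractor_empty_subset[OF assms(5)]
    by (intro upper_box_dim_mono[OF assms(1)]) auto
  ultimately show ?thesis using upper_box_dim_attractor_le[OF assms(5)] by simp
qed

end
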